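(* For any $\varepsilon>0$, if $k(n)=\varepsilon\log n$ for $n\in\mathbb{N}$, then there exists a $k$-GP-free sequence $T$ with gaps of size $O(1)$.
   Context: $\mathbb{N}$ is the set of positive integers, and $\log$ is the natural logarithm. Sequences $S,T$ are increasing sequences of positive integers, identified with their sets of terms. A geometric progression of positive integers is nontrivial if its common ratio (a rational number) is not equal to $1$ (in particular it has at least two terms); its length is its number of terms. For a nondecreasing function $k$ on $\mathbb{N}$, a sequence $S$ is $k$-GP-free if for every $N\in\mathbb{N}$ the set $S\cap\{1,2,\ldots,N\}$ contains no nontrivial geometric progression of length at least $k(N)$. A sequence $S$ has gaps of size $O(1)$ if there exists a constant $C>0$ such that for every $m\in\mathbb{N}$, $S$ intersects the interval $[m,m+C)$. *)

theory Defs
  imports Complex_Main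
begin

text \<open>
  A finite geometric progression is represented by the list of its terms in order; its length is
  the length of the list. A ratio less than 1 is allowed. Positivity of the terms forces the
  ratio to be positive, and \<^term>\<open>r \<noteq> 1\<close> then makes the terms pairwise distinct.
\<close>

definition nontrivial_gp :: "nat list \<Rightarrow> bool" where
  "nontrivial_gp xs \<longleftrightarrow>
     2 \<le> length xs \<and> (\<forall>x \<in> set xs. 0 < x) \<and>
     (\<exists>r :: rat. r \<noteq> 1 \<and>
        (\<forall>i. Suc i < length xs \<longrightarrow> rat_of_nat (xs ! Suc i) = r * rat_of_nat (xs ! i)))"

text \<open>
  The notion is intended for \<open>k\<close> nondecreasing on the positive integers; the value \<open>k 0\<close> is
  irrelevant. Only finite progressions matter, since \<^term>\<open>{1..N}\<close> is finite.
\<close>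

definition gp_free :: "(nat \<Rightarrow> real) \<Rightarrow> nat set \<Rightarrow> bool" where
  "gp_free k S \<longleftrightarrow>
     (\<forall>N \<ge> 1. \<not> (\<exists>xs. nontrivial_gp xs \<and> set xs \<subseteq> S \<inter> {1..N} \<and> k N \<le> real (length xs)))"

definition bounded_gaps :: "nat set \<Rightarrow> bool" where
  "bounded_gaps S \<longleftrightarrow>
     (\<exists>C :: real. C > 0 \<and> (\<forall>m :: nat. m \<ge> 1 \<longrightarrow> (\<exists>s \<in> S. real m \<le> real s \<and> real s < real m + C)))"

end

theory Submission
  imports Defs
begin

text \<open>
  Take \<open>T\<close> to be the residue class of \<open>1\<close> modulo \<open>R!\<close> with \<open>R\<close> large in terms of \<open>\<epsilon>\<close>; its gaps
  are constant. No term of \<open>T\<close> has a divisor \<open>t\<close> with \<open>2 \<le> t \<le> R\<close>. On the other hand, a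
  nontrivial progression of length \<open>L\<close> with ratio \<open>p / q\<close> in lowest terms has its first term
  divisible by \<open>q ^ (L - 1)\<close> and its last term divisible by \<open>p ^ (L - 1)\<close>, and one of \<open>p\<close>, \<open>q\<close> is
  at least \<open>2\<close> (\<open>nontrivial_gp_power_dvd\<close>). If the terms lie in \<open>T\<close> and are at most \<open>N\<close>, this
  forces \<open>(R + 1) ^ (L - 1) \<le> N\<close>. As \<open>L \<le> 2 * (L - 1)\<close>, choosing \<open>R\<close> with
  \<open>\<epsilon> * ln (R + 1) > 2\<close> gives \<open>L < \<epsilon> * ln N\<close>.
\<close>

lemma nontrivial_gp_power_dvd:
  assumes "nontrivial_gp xs"
  shows "\<exists>t \<ge> 2. \<exists>y \<in> set xs. t ^ (length xs - 1) dvd y"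
proof -
  from assms obtain r :: rat where len: "2 \<le> length xs"
    and pos: "\<forall>x \<in> set xs. 0 < x" and r: "r \<noteq> 1"
    and step: "\<And>i. Suc i < length xs \<Longrightarrow> rat_of_nat (xs ! Suc i) = r * rat_of_nat (xs ! i)"
    unfolding nontrivial_gp_def by blast
  define g where "g = gcd (xs ! 1) (xs ! 0)"
  have p0: "0 < xs ! 0" and p1: "0 < xs ! 1"
    by (rule bspec[OF pos nth_mem]; use len in linarith)+
  then have "g \<noteq> 0" by (simp add: g_def)
  then obtain p q where x1: "xs ! 1 = p * g" and x0: "xs ! 0 = q * g" and cop: "coprime p q"
    using gcd_coprime_exists[of "xs ! 1" "xs ! 0"] unfolding g_def by auto
  have q0: "0 < q" and pp: "0 < p" using p0 p1 x0 x1 by auto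
  have "rat_of_nat p * of_nat g = r * (of_nat q * of_nat g)"
    using step[of 0] len x0 x1 by (simp del: of_nat_mult flip: of_nat_mult)
  then have rq: "rat_of_nat p = r * of_nat q"
    using \<open>g \<noteq> 0\<close> by simp
  have "p \<noteq> q" using rq r q0 by auto
  \<comment> \<open>Clearing denominators in \<open>x\<^sub>i = (p / q) ^ i * x\<^sub>0\<close> allows the coprimality of \<open>p\<close> and \<open>q\<close> to be used.\<close>
  have "xs ! i * q ^ i = p ^ i * xs ! 0" if "i < length xs" for i
    using that
  proof (induction i)
    case (Suc i)
    have "rat_of_nat (xs ! Suc i * q) = of_nat (p * xs ! i)"
      using step[OF Suc.prems] rq by simp
    then have "xs ! Suc i * q = p * xs ! i"
      using of_nat_eq_iff by blast
    then have "xs ! Suc i * q ^ Suc i = p * (xs ! i * q ^ i)"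
      by (metis mult.assoc mult.commute power_Suc)
    with Suc show ?case by simp
  qed simp
  from this[of "length xs - 1"]
  have eq: "xs ! (length xs - 1) * q ^ (length xs - 1) = p ^ (length xs - 1) * xs ! 0"
    using len by linarith
  have cop': "coprime (p ^ (length xs - 1)) (q ^ (length xs - 1))"
    using cop by simp
  have "p ^ (length xs - 1) dvd xs ! (length xs - 1)"
    using eq cop' by (metis coprime_dvd_mult_left_iff dvd_triv_left)
  moreover have "q ^ (length xs - 1) dvd xs ! 0"
    using eq cop' by (metis coprime_commute coprime_dvd_mult_right_iff dvd_triv_right)
  moreover have "xs ! (length xs - 1) \<in> set xs" "xs ! 0 \<in> set xs"
    using len by (auto intro!: nth_mem)
  moreover have "2 \<le> p \<or> 2 \<le> q"
    using \<open>p \<noteq> q\<close> pp q0 by linarith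
  ultimately show ?thesis by blast
qed

lemma divisor_of_Suc_fact_mult:
  fixes t :: nat
  assumes "2 \<le> t" "t dvd Suc (fact R * i)"
  shows "R < t"
proof (rule ccontr)
  assume "\<not> R < t"
  then have "t dvd fact R * i"
    using assms(1) by (simp add: dvd_fact)
  with assms(2) have "t dvd 1"
    using dvd_add_right_iff[of t "fact R * i" 1] by simp
  with assms(1) show False by simp
qed

lemma bounded_gaps_Suc_mult:
  assumes "0 < F"
  shows "bounded_gaps (range (\<lambda>i. Suc (F * i)))"
  unfolding bounded_gaps_def
proof (intro exI[of _ "real (F + 2)"] conjI allI impI)
  fix m :: nat
  define s where "s = Suc (F * Suc (m div F))"
  have "m = F * (m div F) + m mod F" "m mod F < F"
    using assms by simp_all
  then have "m \<le> s" "s < m + (F + 2)"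
    unfolding s_def mult_Suc_right by linarith+
  then have "real m \<le> real s \<and> real s < real m + real (F + 2)"
    by linarith
  moreover have "s \<in> range (\<lambda>i. Suc (F * i))"
    unfolding s_def by blast
  ultimately show "\<exists>s \<in> range (\<lambda>i. Suc (F * i)). real m \<le> real s \<and> real s < real m + real (F + 2)"
    by blast
qed simp

lemma gp_free_Suc_fact_mult:
  assumes "0 < \<epsilon>" and R: "2 < \<epsilon> * ln (real R + 1)"
  shows "gp_free (\<lambda>n. \<epsilon> * ln (real n)) (range (\<lambda>i. Suc (fact R * i)))"
  unfolding gp_free_def
proof (intro allI impI notI, elim exE conjE)
  fix N :: nat and xs
  assume gp: "nontrivial_gp xs" and sub: "set xs \<subseteq> range (\<lambda>i. Suc (fact R * i)) \<inter> {1..N}"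
    and long: "\<epsilon> * ln (real N) \<le> real (length xs)"
  define l where "l = length xs - 1"
  have l: "1 \<le> l" "length xs = Suc l"
    using gp by (auto simp: nontrivial_gp_def l_def)
  obtain t y where t: "2 \<le> t" "y \<in> set xs" "t ^ l dvd y"
    using nontrivial_gp_power_dvd[OF gp] unfolding l_def by blast
  then obtain i where i: "y = Suc (fact R * i)" and y: "1 \<le> y" "y \<le> N"
    using subsetD[OF sub t(2)] by auto
  have "t dvd y" using t(3) l(1) by (metis dvd_power dvd_trans not_one_le_zero gr0I)
  then have "R < t"
    using t(1) i divisor_of_Suc_fact_mult by blast
  then have "(R + 1) ^ l \<le> t ^ l" by (simp add: power_mono)
  also have "\<dots> \<le> N" using dvd_imp_le[OF t(3)] y by linarith
  finally have "(real R + 1) ^ l \<le> real N"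
    by (metis of_nat_1 of_nat_add of_nat_le_iff of_nat_power)
  then have "ln ((real R + 1) ^ l) \<le> ln (real N)"
    using y by (subst ln_le_cancel_iff) auto
  then have "real l * ln (real R + 1) \<le> ln (real N)"
    by (simp add: ln_realpow)
  then have "real l * (\<epsilon> * ln (real R + 1)) \<le> \<epsilon> * ln (real N)"
    using mult_left_mono[of _ _ \<epsilon>] \<open>0 < \<epsilon>\<close> by (fastforce simp: mult.left_commute)
  moreover have "real l * 2 < real l * (\<epsilon> * ln (real R + 1))"
    using R l(1) by simp
  \<comment> \<open>The length \<open>l + 1\<close> is at most \<open>2 * l\<close>, since \<open>1 \<le> l\<close>.\<close>
  ultimately show False using long l by simp
qed

theorem proposition10:
  fixes \<epsilon> :: real
  assumes "\<epsilon> > 0"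
  shows "\<exists>T :: nat \<Rightarrow> nat. strict_mono T \<and> (\<forall>i. T i > 0) \<and>
           gp_free (\<lambda>n. \<epsilon> * ln (real n)) (range T) \<and> bounded_gaps (range T)"
proof -
  obtain R :: nat where "exp (2 / \<epsilon>) < real R"
    using reals_Archimedean2 by blast
  then have "2 / \<epsilon> < ln (real R + 1)"
    by (subst exp_less_cancel_iff[symmetric]) simp
  then have "2 < \<epsilon> * ln (real R + 1)"
    using assms by (simp add: field_simps)
  then have "gp_free (\<lambda>n. \<epsilon> * ln (real n)) (range (\<lambda>i. Suc (fact R * i)))"
    using gp_free_Suc_fact_mult assms by blast
  moreover have "strict_mono (\<lambda>i. Suc (fact R * i))"
    by (simp add: strict_mono_def)
  moreover have "bounded_gaps (range (\<lambda>i. Suc (fact R * i)))"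
    by (rule bounded_gaps_Suc_mult) simp
  ultimately show ?thesis
    by (intro exI[of _ "\<lambda>i. Suc (fact R * i)"]) simp
qed

end
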